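(* Let $\mathfrak{g}$ be a deg1 pre-Lie algebra. Then, up to an equivalence, $\mathfrak{g}$ is a direct sum of fundamental deg1 pre-Lie algebras. That is, $\mathfrak g$ is equivalent to a deg1 pre-Lie algebra which is the direct sum of fundamental deg1 pre-Lie algebras.
   Context: $\mathbb{K}$ is the base field; $M,N$ are positive integers; $[M]=\{1,\dots,M\}$; $\mathbb{N}^N_*=\mathbb{N}^N\setminus\{0\}$ (with $0\in\mathbb N$); $\cdot$ is the usual inner product $\mathbb{K}^N\times\mathbb{K}^N\to\mathbb{K}$, also applied to $\alpha\in\mathbb N^N$. A (left) pre-Lie algebra is a vector space with a bilinear product $*$ such that $(x*y)*z-x*(y*z)=(y*x)*z-y*(x*z)$ for all $x,y,z$. A pre-Lie algebra $(\mathfrak g,* )$ is deg1 if it has a basis $(f_i(\alpha))_{i\in[M],\alpha\in\mathbb{N}^N_*}$ and there are $A^{(i,j)}\in\mathbb{K}^N$, $b^{(i,j)}\in\mathbb{K}$ (the structure coefficients) such that for all $i,j\in[M]$, $\alpha,\beta\in\mathbb N^N_*$: $$f_j(\beta)*f_i(\alpha)=(A^{(i,j)}\cdot\alpha+b^{(i,j)})\,f_i(\alpha+\beta).$$ Equivalence: the deg1 pre-Lie algebras with structure coefficients $(A^{(i,j)},b^{(i,j)})$ and $(\lambda_jA^{(i,j)},\lambda_jb^{(i,j)})$, where $\lambda_1,\dots,\lambda_M\in\mathbb{K}\setminus\{0\}$, are called equivalent (they are isomorphic through the rescaling $g_i(\alpha)=\lambda_if_i(\alpha)$ of the basis). Fundamental: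 a deg1 pre-Lie algebra is fundamental if there are a partition $[M]=I_0\sqcup\dots\sqcup I_k$ with $I_1,\dots,I_k\neq\emptyset$ ($I_0$ may be empty), $A_1,\dots,A_k\in\mathbb{K}^N$, $b_1,\dots,b_k\in\mathbb{K}$, and $b^{(i)}_p\in\mathbb{K}$ for $i\in I_0$, $p\in[k]$, such that $A^{(i,j)}=A_q$ if $j\in I_q$ with $q\ge1$, and $A^{(i,j)}=0$ if $j\in I_0$; $b^{(i,j)}=\delta_{p,q}b_q$ if $j\in I_q$, $i\in I_p$ with $p,q\ge1$; $b^{(i,j)}=0$ if $j\in I_0$; $b^{(i,j)}=b^{(i)}_q$ if $j\in I_q$ with $q\geq1$ and $i\in I_0$. Direct sum: the index set $[M]$ is partitioned into subsets, each summand is spanned by the $f_i(\alpha)$ with $i$ in one of these subsets and $\alpha\in\mathbb N^N_*$ (and is a fundamental deg1 pre-Lie algebra up to re-indexing), and products of elements of different summands are zero. *)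

theory Defs
  imports "HOL-Analysis.Finite_Cartesian_Product" "HOL-Library.Disjoint_Sets"
begin

definition nonzero_exponents :: "(nat ^ 'n::finite) set" where
  "nonzero_exponents = {\<alpha>. \<alpha> \<noteq> 0}"

definition dot_nat :: "'k::field ^ 'n::finite \<Rightarrow> nat ^ 'n \<Rightarrow> 'k" where
  "dot_nat A \<alpha> = (\<Sum>r\<in>UNIV. A $ r * of_nat (\<alpha> $ r))"

text \<open>Left pre-Lie algebras. The underlying vector space is a subspace \<open>V\<close> of an ambient
  vector space, so that subalgebras (such as the summands of a direct sum) are again instances.
  The product \<open>mult\<close> is only constrained on \<open>V\<close>.\<close>

locale pre_lie_algebra = vector_space smul
  for smul :: "'k::field \<Rightarrow> 'g::ab_group_add \<Rightarrow> 'g" +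
  fixes V :: "'g set"
    and mult :: "'g \<Rightarrow> 'g \<Rightarrow> 'g"
  assumes subspace_carrier: "subspace V"
    and mult_closed: "\<And>x y. x \<in> V \<Longrightarrow> y \<in> V \<Longrightarrow> mult x y \<in> V"
    and mult_add_left:
      "\<And>x y z. x \<in> V \<Longrightarrow> y \<in> V \<Longrightarrow> z \<in> V \<Longrightarrow> mult (x + y) z = mult x z + mult y z"
    and mult_add_right:
      "\<And>x y z. x \<in> V \<Longrightarrow> y \<in> V \<Longrightarrow> z \<in> V \<Longrightarrow> mult x (y + z) = mult x y + mult x z"
    and mult_scale_left:
      "\<And>c x y. x \<in> V \<Longrightarrow> y \<in> V \<Longrightarrow> mult (smul c x) y = smul c (mult x y)"
    and mult_scale_right:
      "\<And>c x y. x \<in> V \<Longrightarrow> y \<in> V \<Longrightarrow> mult x (smul c y) = smul c (mult x y)"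
    and pre_lie:
      "\<And>x y z. x \<in> V \<Longrightarrow> y \<in> V \<Longrightarrow> z \<in> V \<Longrightarrow>
         mult (mult x y) z - mult x (mult y z) = mult (mult y x) z - mult y (mult x z)"

text \<open>The indices range over a finite nonempty set \<open>I\<close> instead of \<open>{1..M}\<close>; this makes the
  re-indexing of direct summands unnecessary. Only the values of \<open>f\<close>, \<open>A\<close>, \<open>b\<close> at indices
  in \<open>I\<close> and nonzero exponents matter.\<close>

locale deg1_pre_lie_algebra = pre_lie_algebra smul V mult
  for smul :: "'k::field \<Rightarrow> 'g::ab_group_add \<Rightarrow> 'g"
    and V :: "'g set"
    and mult :: "'g \<Rightarrow> 'g \<Rightarrow> 'g" +
  fixes I :: "'i set"
    and f :: "'i \<Rightarrow> nat ^ 'n::finite \<Rightarrow> 'g"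
    and A :: "'i \<Rightarrow> 'i \<Rightarrow> 'k ^ 'n"
    and b :: "'i \<Rightarrow> 'i \<Rightarrow> 'k"
  assumes finite_index: "finite I"
    and nonempty_index: "I \<noteq> {}"
    and basis_inj: "inj_on (\<lambda>(i, \<alpha>). f i \<alpha>) (I \<times> nonzero_exponents)"
    and basis_independent: "independent ((\<lambda>(i, \<alpha>). f i \<alpha>) ` (I \<times> nonzero_exponents))"
    and basis_span: "span ((\<lambda>(i, \<alpha>). f i \<alpha>) ` (I \<times> nonzero_exponents)) = V"
    and mult_basis:
      "\<And>i j \<alpha> \<beta>. i \<in> I \<Longrightarrow> j \<in> I \<Longrightarrow> \<alpha> \<in> nonzero_exponents \<Longrightarrow> \<beta> \<in> nonzero_exponents \<Longrightarrow>
         mult (f j \<beta>) (f i \<alpha>) = smul (dot_nat (A i j) \<alpha> + b i j) (f i (\<alpha> + \<beta>))"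

definition deg1_equivalent ::
  "'i set \<Rightarrow> ('i \<Rightarrow> 'i \<Rightarrow> 'k::field ^ 'n::finite) \<Rightarrow> ('i \<Rightarrow> 'i \<Rightarrow> 'k)
     \<Rightarrow> ('i \<Rightarrow> 'i \<Rightarrow> 'k ^ 'n) \<Rightarrow> ('i \<Rightarrow> 'i \<Rightarrow> 'k) \<Rightarrow> bool" where
  "deg1_equivalent I A b A' b' \<longleftrightarrow>
     (\<exists>l. (\<forall>j\<in>I. l j \<noteq> 0) \<and>
          (\<forall>i\<in>I. \<forall>j\<in>I. A' i j = l j *s A i j \<and> b' i j = l j * b i j))"

text \<open>\<open>J 0\<close> may be empty, and \<open>k = 0\<close> is allowed.\<close>

definition fundamental_coeffs ::
  "'i set \<Rightarrow> ('i \<Rightarrow> 'i \<Rightarrow> 'k::field ^ 'n::finite) \<Rightarrow> ('i \<Rightarrow> 'i \<Rightarrow> 'k) \<Rightarrow> bool" where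
  "fundamental_coeffs I A b \<longleftrightarrow>
     (\<exists>(k::nat) (J :: nat \<Rightarrow> 'i set) (A1 :: nat \<Rightarrow> 'k ^ 'n) (b1 :: nat \<Rightarrow> 'k)
        (b0 :: 'i \<Rightarrow> nat \<Rightarrow> 'k).
        disjoint_family_on J {0..k} \<and> (\<Union>q\<in>{0..k}. J q) = I \<and> (\<forall>q\<in>{1..k}. J q \<noteq> {}) \<and>
        (\<forall>i\<in>I. \<forall>q\<in>{1..k}. \<forall>j\<in>J q. A i j = A1 q) \<and>
        (\<forall>i\<in>I. \<forall>j\<in>J 0. A i j = 0) \<and>
        (\<forall>p\<in>{1..k}. \<forall>q\<in>{1..k}. \<forall>i\<in>J p. \<forall>j\<in>J q. b i j = (if p = q then b1 q else 0)) \<and>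
        (\<forall>i\<in>I. \<forall>j\<in>J 0. b i j = 0) \<and>
        (\<forall>i\<in>J 0. \<forall>q\<in>{1..k}. \<forall>j\<in>J q. b i j = b0 i q))"

locale fundamental_deg1_pre_lie_algebra = deg1_pre_lie_algebra smul V mult I f A b
  for smul :: "'k::field \<Rightarrow> 'g::ab_group_add \<Rightarrow> 'g"
    and V :: "'g set"
    and mult :: "'g \<Rightarrow> 'g \<Rightarrow> 'g"
    and I :: "'i set"
    and f :: "'i \<Rightarrow> nat ^ 'n::finite \<Rightarrow> 'g"
    and A :: "'i \<Rightarrow> 'i \<Rightarrow> 'k ^ 'n"
    and b :: "'i \<Rightarrow> 'i \<Rightarrow> 'k" +
  assumes fundamental: "fundamental_coeffs I A b"

definition summand ::
  "('k::field \<Rightarrow> 'g::ab_group_add \<Rightarrow> 'g) \<Rightarrow> ('i \<Rightarrow> nat ^ 'n::finite \<Rightarrow> 'g) \<Rightarrow> 'i set \<Rightarrow> 'g set" where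
  "summand smul f S = module.span smul ((\<lambda>(i, \<alpha>). f i \<alpha>) ` (S \<times> nonzero_exponents))"

text \<open>That \<open>V\<close> is the direct sum of the summands as a vector space is automatic here, because
  the \<open>f i \<alpha>\<close> form a basis of \<open>V\<close> and the blocks of \<open>P\<close> partition the index set.\<close>

definition direct_sum_of_fundamental ::
  "('k::field \<Rightarrow> 'g::ab_group_add \<Rightarrow> 'g) \<Rightarrow> 'g set \<Rightarrow> ('g \<Rightarrow> 'g \<Rightarrow> 'g) \<Rightarrow> 'i set
     \<Rightarrow> ('i \<Rightarrow> nat ^ 'n::finite \<Rightarrow> 'g) \<Rightarrow> ('i \<Rightarrow> 'i \<Rightarrow> 'k ^ 'n) \<Rightarrow> ('i \<Rightarrow> 'i \<Rightarrow> 'k) \<Rightarrow> bool" where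
  "direct_sum_of_fundamental smul V mult I f A b \<longleftrightarrow>
     deg1_pre_lie_algebra smul V mult I f A b \<and>
     (\<exists>P. partition_on I P \<and>
          (\<forall>S\<in>P. fundamental_deg1_pre_lie_algebra smul (summand smul f S) mult S f A b) \<and>
          (\<forall>S\<in>P. \<forall>T\<in>P. S \<noteq> T \<longrightarrow>
             (\<forall>x\<in>summand smul f S. \<forall>y\<in>summand smul f T. mult x y = 0)))"

end

theory Submission imports Defs begin

text \<open>
  Write \<open>P i j \<alpha> = A i j \<cdot> \<alpha> + b i j\<close>. Evaluated on basis vectors \<open>f j \<beta>\<close>, \<open>f k \<gamma>\<close>, \<open>f i \<alpha>\<close>, the
  pre-Lie identity is an identity between scalars in which the terms quadratic in \<open>\<alpha>\<close> cancel.
  What is left is affine in each of \<open>\<alpha>\<close>, \<open>\<beta>\<close>, \<open>\<gamma>\<close>, so its coefficients can be compared over a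
  field of any characteristic. This gives, for all \<open>i\<close>, \<open>j\<close>, \<open>k\<close>,
    \<^item> \<open>A k j = A i j\<close>, or else \<open>A i k = 0\<close> and \<open>b i k = 0\<close> (lemma \<open>row_eq_or_zero\<close>);
    \<^item> \<open>b k j A i k = b j k A i j\<close> (lemma \<open>mixed_relation\<close>);
    \<^item> \<open>b i k b k j = b i j b j k\<close> (lemma \<open>const_relation\<close>).

  A rescaling of the basis makes every \<open>b j j\<close> equal to \<open>0\<close> or \<open>1\<close>. Now call two indices
  equivalent if their rows \<open>A i _\<close> agree. By the first relation, \<open>A i k\<close> and \<open>b i k\<close> vanish when
  \<open>i\<close> and \<open>k\<close> are not equivalent, so the equivalence classes give a direct sum decomposition.

  Inside one class \<open>A i j\<close> depends on \<open>j\<close> only. Let \<open>J 0\<close> be the set of those \<open>j\<close> whose columns of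
  \<open>A\<close> and \<open>b\<close> vanish. If \<open>i\<close> is not in \<open>J 0\<close> and \<open>b i j \<noteq> 0\<close>, the last two relations force
  \<open>b i j = b j i = b i i = b j j = 1\<close> and \<open>A i i = A j j\<close> (lemma \<open>active_nonzero_imp_one\<close>). Hence
  \<open>i = j \<or> b i j \<noteq> 0\<close> is an equivalence relation outside \<open>J 0\<close>, and its classes are the blocks
  of a fundamental algebra (lemma \<open>fundamental_coeffs_of_relations\<close>). An index \<open>j\<close> outside \<open>J 0\<close>
  with \<open>b j j = 0\<close> is a block of its own.
\<close>

section \<open>Linear algebra\<close>

lemma (in vector_space) rescaled_family:
  assumes inj: "inj_on F X" and indep: "independent (F ` X)" and c: "\<And>x. x \<in> X \<Longrightarrow> c x \<noteq> 0"
  shows rescaled_family_inj: "inj_on (\<lambda>x. scale (c x) (F x)) X"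
    and rescaled_family_independent: "independent ((\<lambda>x. scale (c x) (F x)) ` X)"
    and rescaled_family_span: "span ((\<lambda>x. scale (c x) (F x)) ` X) = span (F ` X)"
proof -
  let ?G = "\<lambda>x. scale (c x) (F x)"
  have mem: "F x \<in> W" if "subspace W" "?G x \<in> W" "x \<in> X" for x W
  proof -
    have "scale (inverse (c x)) (?G x) \<in> W"
      using that subspace_scale by blast
    then show ?thesis
      using c[OF \<open>x \<in> X\<close>] by simp
  qed
  have notin: "F x \<notin> span (F ` X - {F x})" if "x \<in> X" for x
    using indep that unfolding dependent_def by blast
  have G_other: "?G y \<in> span (F ` X - {F x})" if "x \<in> X" "y \<in> X" "x \<noteq> y" for x y
  proof (rule span_scale, rule span_base)
    show "F y \<in> F ` X - {F x}"
      using that inj by (auto dest: inj_onD)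
  qed
  show inj_G: "inj_on ?G X"
  proof (rule inj_onI, rule ccontr)
    fix x y assume xy: "x \<in> X" "y \<in> X" "?G x = ?G y" "x \<noteq> y"
    have "?G x \<in> span (F ` X - {F x})"
      using G_other[of x y] xy by simp
    then show False
      using mem[OF subspace_span] notin xy(1) by blast
  qed
  show "independent (?G ` X)"
    unfolding dependent_def
  proof clarify
    fix x assume x: "x \<in> X" "?G x \<in> span (?G ` X - {?G x})"
    have "?G ` X - {?G x} \<subseteq> span (F ` X - {F x})"
      using G_other[OF x(1)] by blast
    then have "?G x \<in> span (F ` X - {F x})"
      using x(2) span_minimal[OF _ subspace_span] by blast
    then show False
      using mem[OF subspace_span] notin x(1) by blast
  qed
  show "span (?G ` X) = span (F ` X)"
  proof
    show "span (?G ` X) \<subseteq> span (F ` X)"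
      by (rule span_minimal) (auto intro: span_scale span_base)
    have "F x \<in> span (?G ` X)" if "x \<in> X" for x
      by (rule mem[OF subspace_span _ that], rule span_base) (use that in blast)
    then show "span (F ` X) \<subseteq> span (?G ` X)"
      by (intro span_minimal) auto
  qed
qed

lemma dot_nat_add: "dot_nat A (\<alpha> + \<beta>) = dot_nat A \<alpha> + dot_nat A \<beta>"
  by (simp add: dot_nat_def sum.distrib algebra_simps)

lemma dot_nat_axis: "dot_nat A (axis r 1) = A $ r"
proof -
  have "dot_nat A (axis r 1) = (\<Sum>s\<in>UNIV. if s = r then A $ s else 0)"
    unfolding dot_nat_def by (rule sum.cong) (auto simp: axis_def)
  then show ?thesis
    by simp
qed

lemma dot_nat_scale: "dot_nat (c *s A) \<alpha> = c * dot_nat A \<alpha>"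
  by (simp add: dot_nat_def sum_distrib_left mult.assoc)

lemma dot_nat_zero [simp]: "dot_nat 0 \<alpha> = 0"
  by (simp add: dot_nat_def)

lemma axis_nonzero_exponents: "axis r 1 \<in> nonzero_exponents"
  by (auto simp: nonzero_exponents_def axis_eq_0_iff)

lemma add_nonzero_exponents: "\<alpha> \<in> nonzero_exponents \<Longrightarrow> \<alpha> + \<beta> \<in> nonzero_exponents"
  by (auto simp: nonzero_exponents_def vec_eq_iff)

text \<open>The constant term of an affine function is not one of its values on nonzero exponents;
  it is recovered after the linear part, which is a difference of two such values.\<close>

lemma affine_zero_on_nonzero_exponents:
  fixes u :: "'k::field ^ 'n::finite"
  assumes "\<And>\<alpha>. \<alpha> \<in> nonzero_exponents \<Longrightarrow> dot_nat u \<alpha> + c = 0"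
  shows "u = 0" "c = 0"
proof -
  have *: "u $ r = 0" for r
  proof -
    let ?e = "axis r 1 :: nat ^ 'n"
    have "dot_nat u (?e + ?e) + c = 0" "dot_nat u ?e + c = 0"
      by (intro assms add_nonzero_exponents axis_nonzero_exponents)+
    then show ?thesis
      unfolding dot_nat_add dot_nat_axis by algebra
  qed
  then show "u = 0"
    by (simp add: vec_eq_iff)
  then show "c = 0"
    using assms[OF axis_nonzero_exponents] by simp
qed

section \<open>Relations between the structure coefficients\<close>

context deg1_pre_lie_algebra
begin

lemma basis_in_carrier: "i \<in> I \<Longrightarrow> \<alpha> \<in> nonzero_exponents \<Longrightarrow> f i \<alpha> \<in> V"
  by (subst basis_span[symmetric], rule span_base) force

lemma basis_nonzero:
  assumes "i \<in> I" "\<alpha> \<in> nonzero_exponents"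
  shows "f i \<alpha> \<noteq> 0"
proof
  assume "f i \<alpha> = 0"
  then have "0 \<in> (\<lambda>(i, \<alpha>). f i \<alpha>) ` (I \<times> nonzero_exponents)"
    using assms by force
  then show False
    using basis_independent dependent_zero by metis
qed

lemma scalar_pre_lie:
  assumes ijk: "i \<in> I" "j \<in> I" "k \<in> I"
    and nz: "\<alpha> \<in> nonzero_exponents" "\<beta> \<in> nonzero_exponents" "\<gamma> \<in> nonzero_exponents"
  defines "P \<equiv> \<lambda>i j \<alpha>. dot_nat (A i j) \<alpha> + b i j"
  shows "P k j \<gamma> * P i k \<alpha> - P i k \<alpha> * P i j (\<alpha> + \<gamma>) = P j k \<beta> * P i j \<alpha> - P i j \<alpha> * P i k (\<alpha> + \<beta>)"
proof -
  let ?F = "f i (\<alpha> + \<beta> + \<gamma>)"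
  have m: "mult (f j \<beta>) (f i \<alpha>) = smul (P i j \<alpha>) (f i (\<alpha> + \<beta>))"
    if "i \<in> I" "j \<in> I" "\<alpha> \<in> nonzero_exponents" "\<beta> \<in> nonzero_exponents" for i j \<alpha> \<beta>
    unfolding P_def using mult_basis that by simp
  have left: "mult (mult (f j \<beta>) (f k \<gamma>)) (f i \<alpha>) = smul (P k j \<gamma> * P i k \<alpha>) (f i (\<alpha> + \<beta> + \<gamma>))"
    if "i \<in> I" "j \<in> I" "k \<in> I"
      "\<alpha> \<in> nonzero_exponents" "\<beta> \<in> nonzero_exponents" "\<gamma> \<in> nonzero_exponents" for i j k \<alpha> \<beta> \<gamma>
    using that
    by (simp add: m mult_scale_left basis_in_carrier add_nonzero_exponents ac_simps)
  have right: "mult (f j \<beta>) (mult (f k \<gamma>) (f i \<alpha>))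
      = smul (P i k \<alpha> * P i j (\<alpha> + \<gamma>)) (f i (\<alpha> + \<beta> + \<gamma>))"
    if "i \<in> I" "j \<in> I" "k \<in> I"
      "\<alpha> \<in> nonzero_exponents" "\<beta> \<in> nonzero_exponents" "\<gamma> \<in> nonzero_exponents" for i j k \<alpha> \<beta> \<gamma>
    using that
    by (simp add: m mult_scale_right basis_in_carrier add_nonzero_exponents ac_simps)
  have comm: "\<alpha> + \<gamma> + \<beta> = \<alpha> + \<beta> + \<gamma>"
    by (simp add: ac_simps)
  have "smul (P k j \<gamma> * P i k \<alpha> - P i k \<alpha> * P i j (\<alpha> + \<gamma>)) ?F
      = smul (P j k \<beta> * P i j \<alpha> - P i j \<alpha> * P i k (\<alpha> + \<beta>)) ?F"
    using pre_lie[of "f j \<beta>" "f k \<gamma>" "f i \<alpha>"] ijk nz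
    by (simp add: left right comm basis_in_carrier scale_left_diff_distrib)
  then show ?thesis
    using basis_nonzero[of i "\<alpha> + \<beta> + \<gamma>"] ijk nz add_nonzero_exponents
    by (metis scale_right_imp_eq)
qed

text \<open>The linear part in \<open>\<gamma>\<close> of the pre-Lie identity.\<close>

lemma row_eq_or_zero:
  assumes ijk: "i \<in> I" "j \<in> I" "k \<in> I"
  shows "A k j = A i j \<or> A i k = 0 \<and> b i k = 0"
proof (rule disjCI)
  assume "\<not> (A i k = 0 \<and> b i k = 0)"
  then obtain \<alpha> where \<alpha>: "\<alpha> \<in> nonzero_exponents" "dot_nat (A i k) \<alpha> + b i k \<noteq> 0"
    using affine_zero_on_nonzero_exponents by blast
  have "A k j $ r = A i j $ r" for r
  proof -
    let ?e = "axis r 1 :: nat ^ 'n"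
    have e: "?e \<in> nonzero_exponents" "?e + ?e \<in> nonzero_exponents"
      by (intro add_nonzero_exponents axis_nonzero_exponents)+
    \<comment> \<open>Subtract the identity at \<open>\<gamma> = e\<close> from the identity at \<open>\<gamma> = e + e\<close>.\<close>
    have "(dot_nat (A i k) \<alpha> + b i k) * (A k j $ r - A i j $ r) = 0"
      using scalar_pre_lie[OF ijk \<alpha>(1) e(1) e(1)] scalar_pre_lie[OF ijk \<alpha>(1) e(1) e(2)]
      unfolding dot_nat_add dot_nat_axis by algebra
    then show ?thesis
      using \<alpha>(2) by simp
  qed
  then show "A k j = A i j"
    by (simp add: vec_eq_iff)
qed

text \<open>Once the terms in \<open>\<beta>\<close> and \<open>\<gamma>\<close> are removed by \<open>row_eq_or_zero\<close>, the identity is affine in \<open>\<alpha>\<close>; its linear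
  and constant parts are the two relations that follow.\<close>

lemma affine_relation:
  assumes ijk: "i \<in> I" "j \<in> I" "k \<in> I" and \<alpha>: "\<alpha> \<in> nonzero_exponents"
  shows "dot_nat (b k j *s A i k - b j k *s A i j) \<alpha> + (b i k * b k j - b i j * b j k) = 0"
proof -
  have z: "(dot_nat (A i k) \<alpha> + b i k) * (dot_nat (A k j) \<gamma> - dot_nat (A i j) \<gamma>) = 0"
    if "i \<in> I" "j \<in> I" "k \<in> I" for \<gamma> i j k
    using row_eq_or_zero[OF that] by auto
  have d: "dot_nat (b k j *s A i k - b j k *s A i j) \<alpha>
      = b k j * dot_nat (A i k) \<alpha> - b j k * dot_nat (A i j) \<alpha>"
    by (simp add: dot_nat_def sum_distrib_left sum_subtractf algebra_simps)
  show ?thesis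
    unfolding d
    using scalar_pre_lie[OF ijk \<alpha> \<alpha> \<alpha>] z[OF ijk, of \<alpha>] z[OF ijk(1,3,2), of \<alpha>]
    unfolding dot_nat_add
    by algebra
qed

lemma mixed_relation:
  assumes "i \<in> I" "j \<in> I" "k \<in> I"
  shows "b k j *s A i k = b j k *s A i j"
  using affine_zero_on_nonzero_exponents(1)[OF affine_relation[OF assms]] by simp

lemma const_relation:
  assumes "i \<in> I" "j \<in> I" "k \<in> I"
  shows "b i k * b k j = b i j * b j k"
  using affine_zero_on_nonzero_exponents(2)[OF affine_relation[OF assms]] by simp

section \<open>Rescaling of the basis and restriction to a set of indices\<close>

lemma deg1_rescale:
  assumes l: "\<And>j. j \<in> I \<Longrightarrow> l j \<noteq> 0"
  shows "deg1_pre_lie_algebra smul V mult I (\<lambda>i \<alpha>. smul (l i) (f i \<alpha>))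
           (\<lambda>i j. l j *s A i j) (\<lambda>i j. l j * b i j)"
proof -
  let ?F = "\<lambda>(i, \<alpha>). f i \<alpha>" and ?X = "I \<times> (nonzero_exponents :: (nat ^ 'n) set)"
  have eq: "(\<lambda>(i, \<alpha>). smul (l i) (f i \<alpha>)) = (\<lambda>x. smul (l (fst x)) (?F x))"
    by (auto simp: fun_eq_iff)
  have c: "l (fst x) \<noteq> 0" if "x \<in> ?X" for x
    using l that by auto
  show ?thesis
  proof unfold_locales
    show "finite I" "I \<noteq> {}"
      by (fact finite_index nonempty_index)+
    show "inj_on (\<lambda>(i, \<alpha>). smul (l i) (f i \<alpha>)) ?X"
      unfolding eq using rescaled_family_inj[OF basis_inj basis_independent c] .
    show "independent ((\<lambda>(i, \<alpha>). smul (l i) (f i \<alpha>)) ` ?X)"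
      unfolding eq using rescaled_family_independent[OF basis_inj basis_independent c] .
    have "span ((\<lambda>(i, \<alpha>). smul (l i) (f i \<alpha>)) ` ?X) = span (?F ` ?X)"
      unfolding eq using rescaled_family_span[OF basis_inj basis_independent c] .
    then show "span ((\<lambda>(i, \<alpha>). smul (l i) (f i \<alpha>)) ` ?X) = V"
      unfolding basis_span .
    show "mult (smul (l j) (f j \<beta>)) (smul (l i) (f i \<alpha>))
        = smul (dot_nat (l j *s A i j) \<alpha> + l j * b i j) (smul (l i) (f i (\<alpha> + \<beta>)))"
      if "i \<in> I" "j \<in> I" "\<alpha> \<in> nonzero_exponents" "\<beta> \<in> nonzero_exponents" for i j \<alpha> \<beta>
    proof -
      have V: "f i \<alpha> \<in> V" "f j \<beta> \<in> V" "smul (l i) (f i \<alpha>) \<in> V"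
        using that basis_in_carrier subspace_scale[OF subspace_carrier] by auto
      show ?thesis
        using that V
        by (simp add: mult_scale_left mult_scale_right mult_basis dot_nat_scale
            distrib_left mult.left_commute mult.commute)
    qed
  qed
qed

lemma mult_span_closed:
  assumes XY: "X \<subseteq> V" "Y \<subseteq> V" and W: "subspace W"
    and gen: "\<And>x y. x \<in> X \<Longrightarrow> y \<in> Y \<Longrightarrow> mult x y \<in> W"
    and xy: "x \<in> span X" "y \<in> span Y"
  shows "mult x y \<in> W"
proof -
  have spanV: "span X \<subseteq> V" "span Y \<subseteq> V"
    using XY span_minimal subspace_carrier by auto
  have zero_left: "mult 0 y = 0" if "y \<in> V" for y
    using mult_scale_left[of 0 y 0] that subspace_0[OF subspace_carrier] by simp
  have zero_right: "mult x 0 = 0" if "x \<in> V" for x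
    using mult_scale_right[of x 0 0] that subspace_0[OF subspace_carrier] by simp
  have *: "mult x y \<in> W" if x: "x \<in> X" for x
  proof -
    have "y \<in> V \<and> mult x y \<in> W"
      using xy(2)
    proof (induction rule: span_induct_alt)
      case base
      show ?case
        using zero_right x XY subspace_0[OF W] subspace_0[OF subspace_carrier] by auto
    next
      case (step c u v)
      then have uv: "u \<in> V" "smul c u \<in> V" "x \<in> V"
        using XY x subspace_scale[OF subspace_carrier] by auto
      then have "mult x (smul c u + v) = smul c (mult x u) + mult x v"
        using step.IH by (simp add: mult_add_right mult_scale_right)
      then show ?case
        using step uv gen x subspace_add[OF W] subspace_scale[OF W] subspace_add[OF subspace_carrier]
        by auto
    qed
    then show ?thesis ..
  qed
  have yV: "y \<in> V"
    using xy spanV by blast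
  have "x \<in> V \<and> mult x y \<in> W"
    using xy(1)
  proof (induction rule: span_induct_alt)
    case base
    show ?case
      using zero_left yV subspace_0[OF W] subspace_0[OF subspace_carrier] by auto
  next
    case (step c u v)
    then have uv: "u \<in> V" "smul c u \<in> V"
      using XY subspace_scale[OF subspace_carrier] by auto
    then have "mult (smul c u + v) y = smul c (mult u y) + mult v y"
      using step.IH yV by (simp add: mult_add_left mult_scale_left)
    then show ?case
      using step uv * subspace_add[OF W] subspace_scale[OF W] subspace_add[OF subspace_carrier]
      by auto
  qed
  then show ?thesis ..
qed

lemma basis_image_subset_carrier:
  "S \<subseteq> I \<Longrightarrow> (\<lambda>(i, \<alpha>). f i \<alpha>) ` (S \<times> nonzero_exponents) \<subseteq> V"
  using basis_in_carrier by auto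

lemma deg1_restrict:
  assumes S: "S \<subseteq> I" "S \<noteq> {}"
  shows "deg1_pre_lie_algebra smul (summand smul f S) mult S f A b"
proof -
  let ?B = "(\<lambda>(i, \<alpha>). f i \<alpha>) ` (S \<times> nonzero_exponents)"
  let ?W = "summand smul f S"
  have W: "?W = span ?B"
    by (simp add: summand_def)
  have BV: "?B \<subseteq> V"
    by (rule basis_image_subset_carrier[OF S(1)])
  have WV: "x \<in> V" if "x \<in> ?W" for x
    using span_minimal[OF BV subspace_carrier] W that by blast
  have sub: "S \<times> nonzero_exponents \<subseteq> I \<times> nonzero_exponents"
    using S by auto
  show ?thesis
  proof unfold_locales
    show "subspace ?W"
      by (simp add: W)
    show "mult x y \<in> ?W" if "x \<in> ?W" "y \<in> ?W" for x y
    proof (rule mult_span_closed[OF BV BV])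
      show "subspace ?W" "x \<in> span ?B" "y \<in> span ?B"
        using that by (simp_all add: W)
      fix u v assume "u \<in> ?B" "v \<in> ?B"
      then obtain i j \<alpha> \<beta> where *: "i \<in> S" "j \<in> S" "\<alpha> \<in> nonzero_exponents" "\<beta> \<in> nonzero_exponents"
        "u = f j \<beta>" "v = f i \<alpha>"
        by auto
      then have "f i (\<alpha> + \<beta>) \<in> ?B"
        using add_nonzero_exponents by force
      then have "smul (dot_nat (A i j) \<alpha> + b i j) (f i (\<alpha> + \<beta>)) \<in> ?W"
        unfolding W by (intro span_scale span_base)
      moreover have "i \<in> I" "j \<in> I"
        using * S(1) by auto
      ultimately show "mult u v \<in> ?W"
        using * mult_basis[of i j \<alpha> \<beta>] by simp
    qed
    show "finite S"
      using S finite_index finite_subset by blast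
    show "S \<noteq> {}"
      by fact
    show "inj_on (\<lambda>(i, \<alpha>). f i \<alpha>) (S \<times> nonzero_exponents)"
      using basis_inj sub by (rule inj_on_subset)
    show "independent ?B"
      using basis_independent image_mono[OF sub] by (rule independent_mono)
    show "span ?B = ?W"
      by (simp add: W)
    show "mult (f j \<beta>) (f i \<alpha>) = smul (dot_nat (A i j) \<alpha> + b i j) (f i (\<alpha> + \<beta>))"
      if "i \<in> S" "j \<in> S" "\<alpha> \<in> nonzero_exponents" "\<beta> \<in> nonzero_exponents" for i j \<alpha> \<beta>
      using that S mult_basis by blast
  qed (rule mult_add_left mult_add_right mult_scale_left mult_scale_right pre_lie; rule WV; assumption)+
qed

lemma summand_mult_zero:
  assumes ST: "S \<subseteq> I" "T \<subseteq> I"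
    and z: "\<And>i j. i \<in> T \<Longrightarrow> j \<in> S \<Longrightarrow> A i j = 0 \<and> b i j = 0"
    and xy: "x \<in> summand smul f S" "y \<in> summand smul f T"
  shows "mult x y = 0"
proof -
  have "mult x y \<in> {0}"
  proof (rule mult_span_closed[OF basis_image_subset_carrier[OF ST(1)]
        basis_image_subset_carrier[OF ST(2)] subspace_single_0])
    fix u v
    assume "u \<in> (\<lambda>(i, \<alpha>). f i \<alpha>) ` (S \<times> nonzero_exponents)"
      "v \<in> (\<lambda>(i, \<alpha>). f i \<alpha>) ` (T \<times> nonzero_exponents)"
    then obtain i j \<alpha> \<beta> where *: "i \<in> T" "j \<in> S" "\<alpha> \<in> nonzero_exponents" "\<beta> \<in> nonzero_exponents"
      "u = f j \<beta>" "v = f i \<alpha>"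
      by auto
    then show "mult u v \<in> {0}"
      using ST mult_basis[of i j \<alpha> \<beta>] z[of i j] by auto
  qed (use xy in \<open>simp_all add: summand_def\<close>)
  then show ?thesis
    by simp
qed

end

section \<open>Fundamental coefficients\<close>

text \<open>The hypotheses on \<open>i\<close> say that its column in \<open>A\<close> or in \<open>b\<close> does not vanish on \<open>S\<close>. If
  \<open>b j i\<close> were \<open>0\<close>, both \<open>b i i\<close> and the column of \<open>A\<close> would vanish, and any \<open>l\<close> with \<open>b l i \<noteq> 0\<close>
  would contradict the relation \<open>b l i b i j = b l j b j i\<close>.\<close>

lemma active_nonzero_imp_one:
  fixes A :: "'i \<Rightarrow> 'i \<Rightarrow> 'k::field ^ 'n::finite" and b :: "'i \<Rightarrow> 'i \<Rightarrow> 'k"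
  assumes col: "\<And>i j. i \<in> S \<Longrightarrow> j \<in> S \<Longrightarrow> A i j = A j j"
    and mixed: "\<And>i j k. i \<in> S \<Longrightarrow> j \<in> S \<Longrightarrow> k \<in> S \<Longrightarrow> b k j *s A i k = b j k *s A i j"
    and const: "\<And>i j k. i \<in> S \<Longrightarrow> j \<in> S \<Longrightarrow> k \<in> S \<Longrightarrow> b i k * b k j = b i j * b j k"
    and norm: "\<And>j. j \<in> S \<Longrightarrow> b j j = 0 \<or> b j j = 1"
    and i: "i \<in> S" "\<exists>l\<in>S. A l i \<noteq> 0 \<or> b l i \<noteq> 0" and j: "j \<in> S" and nz: "b i j \<noteq> 0"
  shows "b i j = 1 \<and> b j i = 1 \<and> b i i = 1 \<and> b j j = 1 \<and> A i i = A j j"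
proof -
  have ii: "b i i = b j i"
    using const[OF i(1) j i(1)] nz by simp
  have ji: "b j i \<noteq> 0"
  proof
    assume z: "b j i = 0"
    have "A i i = 0"
      using mixed[OF i(1) j i(1)] z nz by (simp add: vec_eq_iff)
    then obtain l where l: "l \<in> S" "b l i \<noteq> 0"
      using i col by metis
    then show False
      using const[OF l(1) j i(1)] z nz by simp
  qed
  have jj: "b j j = b i j"
    using const[OF j i(1) j] ji by simp
  have one: "b i j = 1" "b j i = 1"
    using norm[OF i(1)] norm[OF j] ii jj ji nz by auto
  moreover have "A i i = A j j"
    using mixed[OF i(1) j i(1)] one col[OF i(1) j] by simp
  ultimately show ?thesis
    using ii jj by simp
qed

lemma fundamental_coeffs_of_relations:
  fixes A :: "'i \<Rightarrow> 'i \<Rightarrow> 'k::field ^ 'n::finite" and b :: "'i \<Rightarrow> 'i \<Rightarrow> 'k"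
  assumes fin: "finite S"
    and col: "\<And>i j. i \<in> S \<Longrightarrow> j \<in> S \<Longrightarrow> A i j = A j j"
    and mixed: "\<And>i j k. i \<in> S \<Longrightarrow> j \<in> S \<Longrightarrow> k \<in> S \<Longrightarrow> b k j *s A i k = b j k *s A i j"
    and const: "\<And>i j k. i \<in> S \<Longrightarrow> j \<in> S \<Longrightarrow> k \<in> S \<Longrightarrow> b i k * b k j = b i j * b j k"
    and norm: "\<And>j. j \<in> S \<Longrightarrow> b j j = 0 \<or> b j j = 1"
  shows "fundamental_coeffs S A b"
proof -
  \<comment> \<open>The indices with a nonvanishing column, and the relation whose classes are the blocks.\<close>
  define Act where "Act = {i\<in>S. \<exists>l\<in>S. A l i \<noteq> 0 \<or> b l i \<noteq> 0}"
  define Q where "Q = {(i, j). i \<in> Act \<and> j \<in> Act \<and> (i = j \<or> b i j \<noteq> 0)}"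
  have one: "b i j = 1 \<and> b j i = 1 \<and> b i i = 1 \<and> b j j = 1 \<and> A i i = A j j"
    if "i \<in> Act" "j \<in> S" "b i j \<noteq> 0" for i j
    using that active_nonzero_imp_one[of S A b i j] col mixed const norm unfolding Act_def by blast
  have equiv: "equiv Act Q"
  proof (rule equivI)
    show "Q \<subseteq> Act \<times> Act"
      by (auto simp: Q_def)
    show "refl_on Act Q"
      by (auto simp: Q_def refl_on_def)
    show "sym Q"
    proof (rule symI)
      fix i j assume "(i, j) \<in> Q"
      then show "(j, i) \<in> Q"
        using one[of i j] unfolding Q_def Act_def by auto
    qed
    show "trans Q"
    proof (rule transI)
      fix i j k assume "(i, j) \<in> Q" "(j, k) \<in> Q"
      moreover from this have "i \<in> S" "j \<in> S" "k \<in> S"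
        by (auto simp: Q_def Act_def)
      ultimately show "(i, k) \<in> Q"
        using const[of i k j] unfolding Q_def by auto
    qed
  qed
  have "finite (Act // Q)"
    by (rule finite_quotient) (use fin in \<open>auto simp: Act_def Q_def\<close>)
  then obtain h where h: "bij_betw h {1..card (Act // Q)} (Act // Q)"
    using ex_bij_betw_nat_finite_1 by blast
  define k where "k = card (Act // Q)"
  define J where "J q = (if q = 0 then S - Act else h q)" for q :: nat
  have h_mem: "h q \<in> Act // Q" if "q \<in> {1..k}" for q
    using h that unfolding k_def by (rule bij_betw_apply)
  have J_pos: "J q = h q" "J q \<noteq> {}" "J q \<subseteq> Act" if "q \<in> {1..k}" for q
  proof -
    show eq: "J q = h q"
      using that by (simp add: J_def)
    show "J q \<noteq> {}" "J q \<subseteq> Act"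
      unfolding eq using h_mem[OF that] in_quotient_imp_non_empty[OF equiv]
        in_quotient_imp_subset[OF equiv] by blast+
  qed
  have Q_iff: "(i, j) \<in> Q \<longleftrightarrow> p = q" if "p \<in> {1..k}" "q \<in> {1..k}" "i \<in> J p" "j \<in> J q" for i j p q
  proof -
    have "(i, j) \<in> Q \<longleftrightarrow> h p = h q"
      using quotient_eq_iff[OF equiv h_mem[OF that(1)] h_mem[OF that(2)]] that J_pos(1) by metis
    also have "\<dots> \<longleftrightarrow> p = q"
      using bij_betw_imp_inj_on[OF h] that(1,2) unfolding k_def inj_on_def by blast
    finally show ?thesis .
  qed
  have rep: "(SOME j. j \<in> J q) \<in> J q" if "q \<in> {1..k}" for q
    using J_pos(2)[OF that] by (simp add: some_in_eq)
  \<comment> \<open>All data of a block can be read off from one representative.\<close>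
  have Q_const: "A i i = A j j" "b i i = b j j" "l \<in> S \<Longrightarrow> b l i = b l j"
    if "(i, j) \<in> Q" for i j l
  proof -
    have ij: "i \<in> S" "j \<in> S" "i \<in> Act" "i = j \<or> b i j \<noteq> 0"
      using that by (auto simp: Q_def Act_def)
    show "A i i = A j j" "b i i = b j j"
      using one[OF ij(3,2)] ij(4) by auto
    show "b l i = b l j" if "l \<in> S"
      using one[OF ij(3,2)] ij(4) const[OF that ij(2,1)] by auto
  qed
  have Act_S: "Act \<subseteq> S"
    by (auto simp: Act_def)
  have J0: "J 0 = S - Act"
    by (simp add: J_def)
  have union: "(\<Union>q\<in>{0..k}. J q) = S"
  proof -
    have "{0..k} = insert 0 {1..k}"
      by auto
    moreover have "(\<Union>q\<in>{1..k}. J q) = \<Union>(h ` {1..k})"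
      using J_pos(1) by simp
    moreover have "\<dots> = Act"
      using bij_betw_imp_surj_on[OF h] Union_quotient[OF equiv] unfolding k_def by simp
    ultimately show ?thesis
      using J0 Act_S by auto
  qed
  have disj: "disjoint_family_on J {0..k}"
    unfolding disjoint_family_on_def
  proof (intro ballI impI)
    fix p q assume pq: "p \<in> {0..k}" "q \<in> {0..k}" "p \<noteq> q"
    show "J p \<inter> J q = {}"
    proof (cases "p = 0 \<or> q = 0")
      case True
      have "J r \<subseteq> Act" if "r \<in> {0..k}" "r \<noteq> 0" for r
        using J_pos(3)[of r] that by simp
      then show ?thesis
        using True pq J0 by auto
    next
      case False
      then have pq': "p \<in> {1..k}" "q \<in> {1..k}"
        using pq by auto
      have "i \<notin> J q" if "i \<in> J p" for i
      proof
        assume "i \<in> J q"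
        moreover have "(i, i) \<in> Q"
          using J_pos(3)[OF pq'(1)] that by (auto simp: Q_def)
        ultimately show False
          using Q_iff[OF pq' that] pq(3) by simp
      qed
      then show ?thesis
        by auto
    qed
  qed
  define r where "r q = (SOME j. j \<in> J q)" for q
  have r_Q: "(j, r q) \<in> Q" if "q \<in> {1..k}" "j \<in> J q" for j q
    using Q_iff[OF that(1) that(1) that(2) rep[OF that(1)]] by (simp add: r_def)
  have J_S: "j \<in> S" "j \<in> Act" if "q \<in> {1..k}" "j \<in> J q" for j q
    using J_pos(3)[OF that(1)] that(2) Act_S by auto
  show ?thesis
    unfolding fundamental_coeffs_def
  proof (rule exI[of _ k], rule exI[of _ J], rule exI[of _ "\<lambda>q. A (r q) (r q)"],
      rule exI[of _ "\<lambda>q. b (r q) (r q)"], rule exI[of _ "\<lambda>i q. b i (r q)"], intro conjI ballI)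
    show "A i j = A (r q) (r q)" if "i \<in> S" "q \<in> {1..k}" "j \<in> J q" for i q j
      using Q_const(1)[OF r_Q[OF that(2,3)]] col[OF that(1) J_S(1)[OF that(2,3)]] by simp
    show "b i j = (if p = q then b (r q) (r q) else 0)"
      if "p \<in> {1..k}" "q \<in> {1..k}" "i \<in> J p" "j \<in> J q" for p q i j
    proof (cases "p = q")
      case True
      then have "(i, j) \<in> Q"
        using Q_iff[OF that] by simp
      then have "b i j = b j j"
        using one[of i j] by (auto simp: Q_def Act_def)
      then show ?thesis
        using True Q_const(2)[OF r_Q[OF that(2,4)]] by simp
    next
      case False
      then have "(i, j) \<notin> Q"
        using Q_iff[OF that] by simp
      then show ?thesis
        using False J_S(2)[OF that(1,3)] J_S(2)[OF that(2,4)] by (auto simp: Q_def)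
    qed
    show "b i j = b i (r q)" if "i \<in> J 0" "q \<in> {1..k}" "j \<in> J q" for i q j
      using Q_const(3)[OF r_Q[OF that(2,3)]] that(1) J0 by simp
    show "A i j = 0" "b i j = 0" if "i \<in> S" "j \<in> J 0" for i j
      using that J0 by (auto simp: Act_def)
  qed (use disj union J_pos(2) in auto)
qed

section \<open>Decomposition into fundamental summands\<close>

lemma (in deg1_pre_lie_algebra) direct_sum_of_fundamental_normalized:
  assumes norm: "\<And>j. j \<in> I \<Longrightarrow> b j j = 0 \<or> b j j = 1"
  shows "direct_sum_of_fundamental smul V mult I f A b"
proof -
  \<comment> \<open>Equality of the rows of \<open>A\<close>; its classes are the index sets of the summands.\<close>
  define R where "R = {(i, k). i \<in> I \<and> k \<in> I \<and> (\<forall>j\<in>I. A i j = A k j)}"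
  have equiv: "equiv I R"
    by (rule equivI) (auto simp: R_def refl_on_def sym_def trans_def)
  have sub: "S \<subseteq> I" "S \<noteq> {}" if "S \<in> I // R" for S
    using in_quotient_imp_subset[OF equiv that] in_quotient_imp_non_empty[OF equiv that] by auto
  have part: "partition_on I (I // R)"
  proof (rule partition_onI)
    show "\<Union>(I // R) = I"
      by (rule Union_quotient[OF equiv])
    show "disjnt S T" if "S \<in> I // R" "T \<in> I // R" "S \<noteq> T" for S T
      using quotient_disj[OF equiv that(1,2)] that(3) by (auto simp: disjnt_def)
  qed (use sub in auto)
  have fund: "fundamental_deg1_pre_lie_algebra smul (summand smul f S) mult S f A b"
    if S: "S \<in> I // R" for S
  proof -
    have "fundamental_coeffs S A b"
    proof (rule fundamental_coeffs_of_relations)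
      show "finite S"
        using sub[OF S] finite_index finite_subset by blast
      show "A i j = A j j" if "i \<in> S" "j \<in> S" for i j
        using quotient_eqI[OF equiv S S that] sub(1)[OF S] that
          quotient_eq_iff[OF equiv S S that] by (auto simp: R_def)
      show "b k j *s A i k = b j k *s A i j" if "i \<in> S" "j \<in> S" "k \<in> S" for i j k
        using mixed_relation[of i j k] sub(1)[OF S] that by blast
      show "b i k * b k j = b i j * b j k" if "i \<in> S" "j \<in> S" "k \<in> S" for i j k
        using const_relation[of i j k] sub(1)[OF S] that by blast
      show "b j j = 0 \<or> b j j = 1" if "j \<in> S" for j
        using norm sub(1)[OF S] that by blast
    qed
    then show ?thesis
      using deg1_restrict[OF sub[OF S]]
      by (simp add: fundamental_deg1_pre_lie_algebra_def fundamental_deg1_pre_lie_algebra_axioms_def)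
  qed
  have "mult x y = 0"
    if ST: "S \<in> I // R" "T \<in> I // R" "S \<noteq> T" and xy: "x \<in> summand smul f S" "y \<in> summand smul f T"
    for S T x y
  proof (rule summand_mult_zero[OF sub(1)[OF ST(1)] sub(1)[OF ST(2)] _ xy])
    fix i j assume ij: "i \<in> T" "j \<in> S"
    then have I: "i \<in> I" "j \<in> I"
      using sub ST by blast+
    have "(i, j) \<notin> R"
      using quotient_eq_iff[OF equiv ST(2,1) ij] ST(3) by simp
    then show "A i j = 0 \<and> b i j = 0"
      using I row_eq_or_zero[of i _ j] unfolding R_def by force
  qed
  then show ?thesis
    unfolding direct_sum_of_fundamental_def
    using part fund deg1_pre_lie_algebra_axioms by blast
qed

theorem theorem24:
  fixes smul :: "'k::field \<Rightarrow> 'g::ab_group_add \<Rightarrow> 'g"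
    and V :: "'g set"
    and mult :: "'g \<Rightarrow> 'g \<Rightarrow> 'g"
    and M :: nat
    and f :: "nat \<Rightarrow> nat ^ 'n::finite \<Rightarrow> 'g"
    and A :: "nat \<Rightarrow> nat \<Rightarrow> 'k ^ 'n"
    and b :: "nat \<Rightarrow> nat \<Rightarrow> 'k"
  assumes "M \<ge> 1"
    and "deg1_pre_lie_algebra smul V mult {1..M} f A b"
  shows "\<exists>g A' b'. deg1_pre_lie_algebra smul V mult {1..M} g A' b' \<and>
           deg1_equivalent {1..M} A b A' b' \<and>
           direct_sum_of_fundamental smul V mult {1..M} g A' b'"
proof -
  define l where "l j = (if b j j = 0 then 1 else inverse (b j j))" for j
  have l: "l j \<noteq> 0" for j
    by (simp add: l_def)
  let ?g = "\<lambda>i \<alpha>. smul (l i) (f i \<alpha>)"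
  let ?A = "\<lambda>i j. l j *s A i j" and ?b = "\<lambda>i j. l j * b i j"
  have deg1: "deg1_pre_lie_algebra smul V mult {1..M} ?g ?A ?b"
    using deg1_pre_lie_algebra.deg1_rescale[OF assms(2), where l = l] l by blast
  moreover have "deg1_equivalent {1..M} A b ?A ?b"
    unfolding deg1_equivalent_def by (rule exI[of _ l]) (simp add: l)
  moreover have "direct_sum_of_fundamental smul V mult {1..M} ?g ?A ?b"
    by (rule deg1_pre_lie_algebra.direct_sum_of_fundamental_normalized[OF deg1]) (simp add: l_def)
  ultimately show ?thesis
    by (intro exI conjI)
qed

end
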